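(* Let $\delta=a+b+c$ and let $\Delta$ be one of $$-a,\ -b,\ -c,\quad a+g/2+1,\ b+g/2+1,\ c+g/2+1,\quad -(\delta+g/2+1),\ \delta+g+2,\quad 1/2-g/2.$$ If $\Delta=0$, then $S\!E_6(a,b,c,g,p,q,r)$ is divisible from the right by a hypergeometric operator $E_2$, that is, $S\!E_6=Q\circ E_2(A,B;C)$ for some parameters $A,B,C$, and the quotient $Q$ is ${\rm ST}_4$ (for suitable values of its parameters).
   Context: Notation: $\partial=d/dx$, $\theta=x\partial$; $a,b,c,g,p,q,r$ are complex parameters. The operator $E_6(e_1,\dots,e_9)$: put $s=(6-e_1-\cdots-e_9)/3$ and $s_{11}=e_1+e_2+e_3$, $s_{12}=e_4+e_5+e_6$, $s_{13}=e_7+e_8+e_9$, $s_{21}=e_1e_2+e_1e_3+e_2e_3$, $s_{22}=e_4e_5+e_4e_6+e_5e_6$, $s_{23}=e_7e_8+e_7e_9+e_8e_9$, $s_{31}=e_1e_2e_3$, $s_{32}=e_4e_5e_6$, $s_{33}=e_7e_8e_9$. Then $E_6=T_0+T_1\partial+T_2\partial^2+T_3\partial^3$ with $T_0=(\theta+s+2)(\theta+s+1)(\theta+s)(\theta+e_7)(\theta+e_8)(\theta+e_9)$, $T_1=(\theta+s+2)(\theta+s+1)B_1$, $B_1=T_{13}\theta^3+T_{12}\theta^2+T_{11}\theta+T_{10}$, $T_2=(\theta+s+2)B_2$, $B_2=T_{23}\theta^3+T_{22}\theta^2+T_{21}\theta+T_{20}$, $T_3=-(\theta+3-e_1)(\theta+3-e_2)(\theta+3-e_3)$,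 where $T_{13}=-3$, $T_{23}=3$, $T_{12}=-9+s_{11}-2s_{13}$, $T_{22}=18+s_{13}-2s_{11}$, $T_{11}=-8+(s_{11}^2+2s_{11}s_{13}-s_{12}^2+s_{13}^2)/3+s_{11}-5s_{13}-s_{21}+s_{22}-2s_{23}$, $T_{21}=35+(-s_{11}^2-2s_{11}s_{13}+s_{12}^2-s_{13}^2)/3-7s_{11}+5s_{13}+2s_{21}-s_{22}+s_{23}$, $T_{20}=-T_{10}+19+(s_{11}^2s_{13}-s_{11}s_{12}^2+s_{11}s_{13}^2-s_{12}^2s_{13})/9+(s_{13}^3+s_{11}^3-2s_{12}^3)/27+(-2s_{11}^2-4s_{11}s_{13}+s_{11}s_{22}+2s_{12}^2+s_{22}s_{12}-2s_{13}^2+s_{22}s_{13})/3-5s_{11}+4s_{13}+3s_{21}-2s_{22}-s_{31}-s_{32}-s_{33}$, $2T_{10}=(2s_{11}+s_{11}^2+2s_{11}s_{13}-s_{12}^2+s_{13}^2-s_{11}s_{21}+2s_{11}s_{23}+s_{12}s_{22}-2s_{13}s_{21}+2s_{13}s_{22}+s_{13}s_{23}-14s_{13})/3+2(s_{11}^2s_{13}-s_{12}^2s_{13})/9+2(s_{11}^3-s_{12}^3)/27-5-s_{21}+s_{31}+s_{22}-s_{32}-5s_{23}-3s_{33}$. The operator $S\!E_6(a,b,c,g,p,q,r)$ is $E_6(e_1,\dots,e_9)$ with $e_1=p+r+1$, $e_2=a+c+p+r+2$, $e_3=2a+2c+g+p+r+3$, $e_4=q+r+1$, $e_5=b+c+q+r+2$,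 $e_6=2b+2c+g+q+r+3$, $e_7=-2c-(p+q+r)-1$, $e_8=-\delta-c-(p+q+r+g)-2$, $e_9=-2\delta-(p+q+r+g)-3$; then $s=-r$. The hypergeometric (Gauss) operator: $E_2(A,B;C)=(\theta+A)(\theta+B)-(\theta+C)\partial$. The operator ${\rm ST}_4(\epsilon_1,\dots,\epsilon_6)=V_0+V_1\partial+V_2\partial^2$, with $\sigma$ defined by $\epsilon_1+\cdots+\epsilon_6+2\sigma+3=6$ and $V_0=(\theta+\sigma+1)(\theta+\sigma)(\theta+\epsilon_5)(\theta+\epsilon_6)$, $V_1=(\theta+\sigma+1)\bigl\{-2\theta^2+(\epsilon_1+\epsilon_2-\epsilon_5-\epsilon_6-4)\theta+\tfrac14\bigl((\epsilon_6-\epsilon_5)^2-(\epsilon_3-\epsilon_4)^2+(\epsilon_1-\epsilon_2)^2+2(\epsilon_1+\epsilon_2-3)(\epsilon_5+\epsilon_6+1)-1\bigr)\bigr\}$, $V_2=(\theta+2-\epsilon_1)(\theta+2-\epsilon_2)$. *)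

theory Defs
  imports Complex_Main "HOL-Computational_Algebra.Polynomial"
begin

text \<open>
  Differential operators in one variable \<open>x\<close> with polynomial coefficients, i.e. the Weyl algebra
  over the complex numbers. It is realised as the subring of the endomorphisms of the polynomials
  generated by the scalars, multiplication by \<open>x\<close> and \<open>d/dx\<close>. Since this action is faithful in
  characteristic 0, equality in the type \<open>diffop\<close> is equality of differential operators.
\<close>

inductive_set diffops :: "(complex poly \<Rightarrow> complex poly) set" where
  scalar: "smult k \<in> diffops"
| mult_x: "(\<lambda>f. [:0, 1:] * f) \<in> diffops"
| deriv: "pderiv \<in> diffops"
| plus: "L \<in> diffops \<Longrightarrow> M \<in> diffops \<Longrightarrow> (\<lambda>f. L f + M f) \<in> diffops"
| compose: "L \<in> diffops \<Longrightarrow> M \<in> diffops \<Longrightarrow> L \<circ> M \<in> diffops"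

lemma diffops_add: "L \<in> diffops \<Longrightarrow> L (f + h) = L f + L h"
  by (induction arbitrary: f h rule: diffops.induct)
    (simp_all add: smult_add_right pderiv_add algebra_simps)

lemma diffops_smult: "L \<in> diffops \<Longrightarrow> L (smult k f) = smult k (L f)"
  by (induction arbitrary: f rule: diffops.induct)
    (simp_all add: smult_add_right pderiv_smult mult.commute)

typedef diffop = diffops
  by (rule exI, rule diffops.scalar)

setup_lifting type_definition_diffop

text \<open>The product of the ring \<open>diffop\<close> is composition of operators.\<close>

instantiation diffop :: ring_1
begin

lift_definition zero_diffop :: diffop is "\<lambda>f. 0"
  using diffops.scalar[of 0] by (metis ext smult_0_left)

lift_definition one_diffop :: diffop is "\<lambda>f. f"
  using diffops.scalar[of 1] by (metis ext smult_1_left)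

lift_definition plus_diffop :: "diffop \<Rightarrow> diffop \<Rightarrow> diffop" is "\<lambda>L M f. L f + M f"
  by (rule diffops.plus)

lift_definition uminus_diffop :: "diffop \<Rightarrow> diffop" is "\<lambda>L f. - L f"
proof -
  fix L assume "L \<in> diffops"
  then have "smult (- 1) \<circ> L \<in> diffops"
    by (intro diffops.compose diffops.scalar)
  then show "(\<lambda>f. - L f) \<in> diffops"
    by (simp add: o_def)
qed

definition minus_diffop :: "diffop \<Rightarrow> diffop \<Rightarrow> diffop" where
  "minus_diffop L M = L + - M"

lift_definition times_diffop :: "diffop \<Rightarrow> diffop \<Rightarrow> diffop" is "\<lambda>L M. L \<circ> M"
  by (rule diffops.compose)

instance
proof
  fix L M N :: diffop
  show "L * M * N = L * (M * N)"
    by transfer (simp add: o_assoc)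
  show "1 * L = L" "L * 1 = L"
    by (transfer, simp add: o_def)+
  show "(L + M) * N = L * N + M * N"
    by transfer (simp add: o_def)
  show "L * (M + N) = L * M + L * N"
    by transfer (simp add: o_def diffops_add)
  show "(0 :: diffop) \<noteq> 1"
    by transfer (metis one_neq_zero)
  show "L + M + N = L + (M + N)" "L + M = M + L" "0 + L = L" "- L + L = 0"
    by (transfer, simp add: algebra_simps)+
  show "L - M = L + - M"
    by (rule minus_diffop_def)
qed

end

lift_definition scal :: "complex \<Rightarrow> diffop" is smult
  by (rule diffops.scalar)

lift_definition X_op :: diffop is "\<lambda>f. [:0, 1:] * f"
  by (rule diffops.mult_x)

lift_definition D_op :: diffop (\<open>\<partial>\<close>) is pderiv
  by (rule diffops.deriv)

definition theta_op :: diffop (\<open>\<theta>\<close>) where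
  "\<theta> = X_op * \<partial>"

lemma D_op_X_op: "\<partial> * X_op = X_op * \<partial> + 1"
  by transfer (simp add: fun_eq_iff pderiv_mult pderiv_pCons algebra_simps)

lemma D_op_theta_op: "\<partial> * \<theta> = (\<theta> + 1) * \<partial>"
  by (metis D_op_X_op mult.assoc theta_op_def)

lemma scal_simps:
  "scal 0 = 0" "scal 1 = 1" "scal (u + v) = scal u + scal v" "scal (u * v) = scal u * scal v"
  by (transfer, simp add: fun_eq_iff smult_add_left)+

lemma scal_commute: "scal u * L = L * scal u"
  by transfer (simp add: fun_eq_iff diffops_smult)

definition E6 :: "complex \<Rightarrow> complex \<Rightarrow> complex \<Rightarrow> complex \<Rightarrow> complex \<Rightarrow> complex \<Rightarrow>
    complex \<Rightarrow> complex \<Rightarrow> complex \<Rightarrow> diffop" where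
  "E6 e1 e2 e3 e4 e5 e6 e7 e8 e9 =
    (let
      s = (6 - (e1 + e2 + e3 + e4 + e5 + e6 + e7 + e8 + e9)) / 3;
      s11 = e1 + e2 + e3;
      s12 = e4 + e5 + e6;
      s13 = e7 + e8 + e9;
      s21 = e1 * e2 + e1 * e3 + e2 * e3;
      s22 = e4 * e5 + e4 * e6 + e5 * e6;
      s23 = e7 * e8 + e7 * e9 + e8 * e9;
      s31 = e1 * e2 * e3;
      s32 = e4 * e5 * e6;
      s33 = e7 * e8 * e9;
      T13 = - 3;
      T23 = 3;
      T12 = - 9 + s11 - 2 * s13;
      T22 = 18 + s13 - 2 * s11;
      T11 = - 8 + (s11^2 + 2 * s11 * s13 - s12^2 + s13^2) / 3
        + s11 - 5 * s13 - s21 + s22 - 2 * s23;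
      T21 = 35 + (- (s11^2) - 2 * s11 * s13 + s12^2 - s13^2) / 3
        - 7 * s11 + 5 * s13 + 2 * s21 - s22 + s23;
      T10 = ((2 * s11 + s11^2 + 2 * s11 * s13 - s12^2 + s13^2 - s11 * s21 + 2 * s11 * s23
            + s12 * s22 - 2 * s13 * s21 + 2 * s13 * s22 + s13 * s23 - 14 * s13) / 3
          + 2 * (s11^2 * s13 - s12^2 * s13) / 9 + 2 * (s11^3 - s12^3) / 27
          - 5 - s21 + s31 + s22 - s32 - 5 * s23 - 3 * s33) / 2;
      T20 = - T10 + 19
        + (s11^2 * s13 - s11 * s12^2 + s11 * s13^2 - s12^2 * s13) / 9
        + (s13^3 + s11^3 - 2 * s12^3) / 27
        + (- 2 * s11^2 - 4 * s11 * s13 + s11 * s22 + 2 * s12^2 + s22 * s12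
            - 2 * s13^2 + s22 * s13) / 3
        - 5 * s11 + 4 * s13 + 3 * s21 - 2 * s22 - s31 - s32 - s33;
      B1 = scal T13 * \<theta>^3 + scal T12 * \<theta>^2 + scal T11 * \<theta> + scal T10;
      B2 = scal T23 * \<theta>^3 + scal T22 * \<theta>^2 + scal T21 * \<theta> + scal T20;
      T0 = (\<theta> + scal (s + 2)) * (\<theta> + scal (s + 1)) * (\<theta> + scal s)
        * (\<theta> + scal e7) * (\<theta> + scal e8) * (\<theta> + scal e9);
      T1 = (\<theta> + scal (s + 2)) * (\<theta> + scal (s + 1)) * B1;
      T2 = (\<theta> + scal (s + 2)) * B2;
      T3 = - ((\<theta> + scal (3 - e1)) * (\<theta> + scal (3 - e2)) * (\<theta> + scal (3 - e3)))
    in T0 + T1 * \<partial> + T2 * \<partial>^2 + T3 * \<partial>^3)"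

definition SE6 :: "complex \<Rightarrow> complex \<Rightarrow> complex \<Rightarrow> complex \<Rightarrow> complex \<Rightarrow> complex \<Rightarrow> complex \<Rightarrow> diffop"
  where
  "SE6 a b c g p q r =
    (let \<delta> = a + b + c in
      E6 (p + r + 1) (a + c + p + r + 2) (2 * a + 2 * c + g + p + r + 3)
         (q + r + 1) (b + c + q + r + 2) (2 * b + 2 * c + g + q + r + 3)
         (- 2 * c - (p + q + r) - 1) (- \<delta> - c - (p + q + r + g) - 2)
         (- 2 * \<delta> - (p + q + r + g) - 3))"

definition E2 :: "complex \<Rightarrow> complex \<Rightarrow> complex \<Rightarrow> diffop" where
  "E2 A B C = (\<theta> + scal A) * (\<theta> + scal B) - (\<theta> + scal C) * \<partial>"

text \<open>The value of \<open>\<sigma>\<close> is the solution of \<open>\<epsilon>1 + \<dots> + \<epsilon>6 + 2 \<sigma> + 3 = 6\<close>.\<close>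

definition ST4 :: "complex \<Rightarrow> complex \<Rightarrow> complex \<Rightarrow> complex \<Rightarrow> complex \<Rightarrow> complex \<Rightarrow> diffop" where
  "ST4 \<epsilon>1 \<epsilon>2 \<epsilon>3 \<epsilon>4 \<epsilon>5 \<epsilon>6 =
    (let
      \<sigma> = (3 - (\<epsilon>1 + \<epsilon>2 + \<epsilon>3 + \<epsilon>4 + \<epsilon>5 + \<epsilon>6)) / 2;
      V0 = (\<theta> + scal (\<sigma> + 1)) * (\<theta> + scal \<sigma>) * (\<theta> + scal \<epsilon>5) * (\<theta> + scal \<epsilon>6);
      V1 = (\<theta> + scal (\<sigma> + 1)) *
        (scal (- 2) * \<theta>^2 + scal (\<epsilon>1 + \<epsilon>2 - \<epsilon>5 - \<epsilon>6 - 4) * \<theta>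
          + scal (1 / 4 * ((\<epsilon>6 - \<epsilon>5)^2 - (\<epsilon>3 - \<epsilon>4)^2 + (\<epsilon>1 - \<epsilon>2)^2
              + 2 * (\<epsilon>1 + \<epsilon>2 - 3) * (\<epsilon>5 + \<epsilon>6 + 1) - 1)));
      V2 = (\<theta> + scal (2 - \<epsilon>1)) * (\<theta> + scal (2 - \<epsilon>2))
    in V0 + V1 * \<partial> + V2 * \<partial>^2)"

end

theory Submission
  imports Defs
begin

text \<open>
  Comparing the coefficients of \<open>\<partial>\<^sup>k\<close> in \<open>E\<^sub>6 = ST\<^sub>4 \<circ> E\<^sub>2(A, B; C)\<close> with \<open>A = s\<close> leads to \<open>B = e\<^sub>j\<close>
  and \<open>C = 1 - e\<^sub>i\<close> with \<open>i \<in> {1, 2, 3}\<close>, \<open>j \<in> {7, 8, 9}\<close>, and makes the exponent \<open>C - A - B\<close> of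
  \<open>E\<^sub>2\<close> at \<open>x = 1\<close> equal to some \<open>e\<^sub>k\<close> with \<open>k \<in> {4, 5, 6}\<close>; the parameters of \<open>ST\<^sub>4\<close> are then the
  other six \<open>e\<close>'s, up to shifts by 1. Given \<open>e\<^sub>i + e\<^sub>k + e\<^sub>j = 1 - s\<close>, the only further obstruction
  is one equation for the accessory parameter \<open>T\<^sub>1\<^sub>0\<close>. For \<open>SE\<^sub>6\<close> both equations hold whenever one
  of the nine \<open>\<Delta>\<close> vanishes, each for its own triple \<open>(i, k, j)\<close>: in the order in which the theorem
  lists the \<open>\<Delta>\<close>, the triples are (1,6,9), (3,4,9), (1,4,7), (3,4,7), (1,6,7), (3,6,9), (1,4,9),
  (3,6,7), (2,5,8).
\<close>

text \<open>Horner evaluation at \<theta>. \<open>poly\<close> is not applicable, since the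
  coefficients are numbers and the value lies in the noncommutative ring \<open>diffop\<close>.
  Polynomials in \<theta> commute with each other, so identities between them can be checked in
  \<open>complex poly\<close>.\<close>

definition at_theta :: "complex poly \<Rightarrow> diffop" where
  "at_theta P = fold_coeffs (\<lambda>k L. scal k + \<theta> * L) P 0"

lemma at_theta_0 [simp]: "at_theta 0 = 0"
  by (simp add: at_theta_def)

lemma at_theta_pCons [simp]: "at_theta (pCons k P) = scal k + \<theta> * at_theta P"
  by (cases "P = 0"; cases "k = 0") (simp_all add: at_theta_def scal_simps)

lemma at_theta_add: "at_theta (P + R) = at_theta P + at_theta R"
  by (induction P R rule: poly_induct2) (simp_all add: scal_simps algebra_simps)

lemma at_theta_minus: "at_theta (- P) = - at_theta P"
  by (metis add.right_inverse add_eq_0_iff at_theta_0 at_theta_add)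

lemma at_theta_smult: "at_theta (smult k P) = scal k * at_theta P"
proof (induction P)
  case (pCons l P)
  then show ?case
    by (simp add: scal_simps distrib_left flip: mult.assoc) (simp add: scal_commute)
qed simp

lemma at_theta_mult: "at_theta (P * R) = at_theta P * at_theta R"
  by (induction P) (simp_all add: at_theta_add at_theta_smult scal_simps algebra_simps)

lemma at_theta_1: "at_theta 1 = 1"
  by (simp add: one_pCons scal_simps)

lemma at_theta_power: "at_theta (P ^ n) = at_theta P ^ n"
  by (induction n) (simp_all add: at_theta_1 at_theta_mult)

lemma at_theta_linear: "at_theta [:k, 1:] = \<theta> + scal k"
  by (simp add: scal_simps add.commute)

lemma at_theta_const: "at_theta [:k:] = scal k"
  by simp

lemmas at_theta_hom = at_theta_add at_theta_minus at_theta_mult at_theta_power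
  at_theta_linear at_theta_const

lemma at_theta_quadratic:
  "scal t2 * \<theta>^2 + scal t1 * \<theta> + scal t0 = at_theta [:t0, t1, t2:]"
proof -
  have "at_theta ([:t2:] * [:0, 1:]^2 + [:t1:] * [:0, 1:] + [:t0:]) = at_theta [:t0, t1, t2:]"
    by (rule arg_cong[where f = at_theta]) (simp add: power2_eq_square)
  then show ?thesis
    unfolding at_theta_hom scal_simps add_0_right .
qed

lemma at_theta_cubic:
  "scal t3 * \<theta>^3 + scal t2 * \<theta>^2 + scal t1 * \<theta> + scal t0 = at_theta [:t0, t1, t2, t3:]"
proof -
  have "at_theta ([:t3:] * [:0, 1:]^3 + [:t2:] * [:0, 1:]^2 + [:t1:] * [:0, 1:] + [:t0:])
      = at_theta [:t0, t1, t2, t3:]"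
    by (rule arg_cong[where f = at_theta]) (simp add: power2_eq_square power3_eq_cube)
  then show ?thesis
    unfolding at_theta_hom scal_simps add_0_right .
qed

text \<open>Each power of \<theta> is handled by iterating \<partial>\<theta> = (\<theta> +
  1)\<partial>; this shift is the only noncommutativity that the computation has to deal
  with.\<close>

lemma D_op_at_theta: "\<partial> * at_theta P = at_theta (P \<circ>\<^sub>p [:1, 1:]) * \<partial>"
proof (induction P)
  case (pCons k P)
  have "\<partial> * at_theta (pCons k P) = \<partial> * scal k + \<partial> * \<theta> * at_theta P"
    by (simp add: distrib_left mult.assoc)
  also have "\<dots> = scal k * \<partial> + (\<theta> + 1) * at_theta (P \<circ>\<^sub>p [:1, 1:]) * \<partial>"
    by (simp add: D_op_theta_op scal_commute mult.assoc pCons.IH)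
  also have "\<dots> = at_theta (pCons k P \<circ>\<^sub>p [:1, 1:]) * \<partial>"
    by (simp add: pcompose_pCons at_theta_add at_theta_mult scal_simps algebra_simps)
  finally show ?case .
qed simp

text \<open>Normal form of the product, with every \<partial> moved to the right of the polynomials
  in \<theta>: the factorization then reduces to comparing polynomial coefficients of the powers of
  \<partial>.\<close>

lemma mult_second_order_at_theta:
  "(at_theta V0 + at_theta V1 * \<partial> + at_theta V2 * \<partial>\<^sup>2) * (at_theta H + at_theta K * \<partial>) =
     at_theta (V0 * H) + at_theta (V0 * K + V1 * (H \<circ>\<^sub>p [:1, 1:])) * \<partial>
     + at_theta (V1 * (K \<circ>\<^sub>p [:1, 1:]) + V2 * (H \<circ>\<^sub>p [:1, 1:] \<circ>\<^sub>p [:1, 1:])) * \<partial>\<^sup>2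
     + at_theta (V2 * (K \<circ>\<^sub>p [:1, 1:] \<circ>\<^sub>p [:1, 1:])) * \<partial>^3"
proof -
  have D: "L * \<partial> * at_theta P = L * at_theta (P \<circ>\<^sub>p [:1, 1:]) * \<partial>" for L P
    by (simp add: mult.assoc D_op_at_theta)
  show ?thesis
    by (simp add: power2_eq_square power3_eq_cube distrib_left distrib_right D at_theta_add
        at_theta_mult flip: mult.assoc)
qed

text \<open>The accessory parameter is kept as a separate constant because it occurs in both
  \<open>E6_B1\<close> and, with opposite sign, \<open>E6_B2\<close>.\<close>

definition E6_T10 :: "complex \<Rightarrow> complex \<Rightarrow> complex \<Rightarrow> complex \<Rightarrow> complex \<Rightarrow> complex \<Rightarrow>
    complex \<Rightarrow> complex \<Rightarrow> complex \<Rightarrow> complex" where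
  "E6_T10 s11 s12 s13 s21 s22 s23 s31 s32 s33 =
    ((2 * s11 + s11^2 + 2 * s11 * s13 - s12^2 + s13^2 - s11 * s21 + 2 * s11 * s23
            + s12 * s22 - 2 * s13 * s21 + 2 * s13 * s22 + s13 * s23 - 14 * s13) / 3
          + 2 * (s11^2 * s13 - s12^2 * s13) / 9 + 2 * (s11^3 - s12^3) / 27
          - 5 - s21 + s31 + s22 - s32 - 5 * s23 - 3 * s33) / 2"

definition E6_B1 :: "complex \<Rightarrow> complex \<Rightarrow> complex \<Rightarrow> complex \<Rightarrow> complex \<Rightarrow> complex \<Rightarrow>
    complex \<Rightarrow> complex \<Rightarrow> complex \<Rightarrow> complex poly" where
  "E6_B1 s11 s12 s13 s21 s22 s23 s31 s32 s33 =
    [: E6_T10 s11 s12 s13 s21 s22 s23 s31 s32 s33,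
       - 8 + (s11^2 + 2 * s11 * s13 - s12^2 + s13^2) / 3
        + s11 - 5 * s13 - s21 + s22 - 2 * s23,
       - 9 + s11 - 2 * s13, - 3 :]"

definition E6_B2 :: "complex \<Rightarrow> complex \<Rightarrow> complex \<Rightarrow> complex \<Rightarrow> complex \<Rightarrow> complex \<Rightarrow>
    complex \<Rightarrow> complex \<Rightarrow> complex \<Rightarrow> complex poly" where
  "E6_B2 s11 s12 s13 s21 s22 s23 s31 s32 s33 =
    [: - E6_T10 s11 s12 s13 s21 s22 s23 s31 s32 s33 + 19
        + (s11^2 * s13 - s11 * s12^2 + s11 * s13^2 - s12^2 * s13) / 9
        + (s13^3 + s11^3 - 2 * s12^3) / 27
        + (- 2 * s11^2 - 4 * s11 * s13 + s11 * s22 + 2 * s12^2 + s22 * s12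
            - 2 * s13^2 + s22 * s13) / 3
        - 5 * s11 + 4 * s13 + 3 * s21 - 2 * s22 - s31 - s32 - s33,
       35 + (- (s11^2) - 2 * s11 * s13 + s12^2 - s13^2) / 3
        - 7 * s11 + 5 * s13 + 2 * s21 - s22 + s23,
       18 + s13 - 2 * s11, 3 :]"

text \<open>Denominators are cleared so that \<open>algebra\<close> applies.\<close>

lemma E6_T10_times_54:
  "54 * E6_T10 s11 s12 s13 s21 s22 s23 s31 s32 s33 =
    9 * (2 * s11 + s11^2 + 2 * s11 * s13 - s12^2 + s13^2 - s11 * s21 + 2 * s11 * s23
          + s12 * s22 - 2 * s13 * s21 + 2 * s13 * s22 + s13 * s23 - 14 * s13)
      + 6 * (s11^2 * s13 - s12^2 * s13) + 2 * (s11^3 - s12^3)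
      + 27 * (s31 + s22 - s32 - 5 - s21 - 5 * s23 - 3 * s33)"
  by (simp add: E6_T10_def field_simps)

lemma E6_at_theta:
  fixes e1 e2 e3 e4 e5 e6 e7 e8 e9 :: complex
  defines "s \<equiv> (6 - (e1 + e2 + e3 + e4 + e5 + e6 + e7 + e8 + e9)) / 3"
    and "s11 \<equiv> e1 + e2 + e3" and "s12 \<equiv> e4 + e5 + e6" and "s13 \<equiv> e7 + e8 + e9"
    and "s21 \<equiv> e1 * e2 + e1 * e3 + e2 * e3" and "s22 \<equiv> e4 * e5 + e4 * e6 + e5 * e6"
    and "s23 \<equiv> e7 * e8 + e7 * e9 + e8 * e9"
    and "s31 \<equiv> e1 * e2 * e3" and "s32 \<equiv> e4 * e5 * e6" and "s33 \<equiv> e7 * e8 * e9"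
  shows "E6 e1 e2 e3 e4 e5 e6 e7 e8 e9 =
    at_theta ([:s + 2, 1:] * [:s + 1, 1:] * [:s, 1:] * [:e7, 1:] * [:e8, 1:] * [:e9, 1:])
    + at_theta ([:s + 2, 1:] * [:s + 1, 1:] * E6_B1 s11 s12 s13 s21 s22 s23 s31 s32 s33) * \<partial>
    + at_theta ([:s + 2, 1:] * E6_B2 s11 s12 s13 s21 s22 s23 s31 s32 s33) * \<partial>\<^sup>2
    + at_theta (- ([:3 - e1, 1:] * [:3 - e2, 1:] * [:3 - e3, 1:])) * \<partial>^3"
  unfolding E6_def Let_def at_theta_cubic E6_B1_def E6_B2_def E6_T10_def s_def s11_def s12_def
    s13_def s21_def s22_def s23_def s31_def s32_def s33_def
  unfolding at_theta_mult at_theta_minus at_theta_linear ..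

text \<open>Each of the three triples enters only through its elementary symmetric functions. Cyclic
  rotations suffice to bring any chosen member of each triple to the front.\<close>

lemma E6_rotate:
  "E6 e2 e3 e1 e4 e5 e6 e7 e8 e9 = E6 e1 e2 e3 e4 e5 e6 e7 e8 e9"
  "E6 e1 e2 e3 e5 e6 e4 e7 e8 e9 = E6 e1 e2 e3 e4 e5 e6 e7 e8 e9"
  "E6 e1 e2 e3 e4 e5 e6 e8 e9 e7 = E6 e1 e2 e3 e4 e5 e6 e7 e8 e9"
  unfolding E6_at_theta by (simp_all only: ac_simps)

lemma ST4_at_theta:
  fixes \<epsilon>1 \<epsilon>2 \<epsilon>3 \<epsilon>4 \<epsilon>5 \<epsilon>6 :: complex
  defines "\<sigma> \<equiv> (3 - (\<epsilon>1 + \<epsilon>2 + \<epsilon>3 + \<epsilon>4 + \<epsilon>5 + \<epsilon>6)) / 2"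
  shows "ST4 \<epsilon>1 \<epsilon>2 \<epsilon>3 \<epsilon>4 \<epsilon>5 \<epsilon>6 =
    at_theta ([:\<sigma> + 1, 1:] * [:\<sigma>, 1:] * [:\<epsilon>5, 1:] * [:\<epsilon>6, 1:])
    + at_theta ([:\<sigma> + 1, 1:] *
        [:1 / 4 * ((\<epsilon>6 - \<epsilon>5)^2 - (\<epsilon>3 - \<epsilon>4)^2 + (\<epsilon>1 - \<epsilon>2)^2
              + 2 * (\<epsilon>1 + \<epsilon>2 - 3) * (\<epsilon>5 + \<epsilon>6 + 1) - 1),
          \<epsilon>1 + \<epsilon>2 - \<epsilon>5 - \<epsilon>6 - 4, - 2:]) * \<partial>
    + at_theta ([:2 - \<epsilon>1, 1:] * [:2 - \<epsilon>2, 1:]) * \<partial>\<^sup>2"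
  unfolding ST4_def Let_def at_theta_quadratic \<sigma>_def
  unfolding at_theta_mult at_theta_linear ..

lemma E2_at_theta: "E2 A B C = at_theta ([:A, 1:] * [:B, 1:]) + at_theta (- [:C, 1:]) * \<partial>"
  unfolding E2_def at_theta_hom by (simp add: algebra_simps)

text \<open>This is the case (i, k, j) = (1, 4, 7). The hypothesis \<open>accessory\<close> is the
  comparison of the constant terms in \<open>B1\<close> below, multiplied by 4.\<close>

lemma E6_eq_ST4_times_E2:
  fixes e1 e2 e3 e4 e5 e6 e7 e8 e9 :: complex
  defines "s \<equiv> (6 - (e1 + e2 + e3 + e4 + e5 + e6 + e7 + e8 + e9)) / 3"
  assumes local_exponents: "e1 + e4 + e7 = 1 - s"
    and accessory: "4 * E6_T10 (e1 + e2 + e3) (e4 + e5 + e6) (e7 + e8 + e9)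
        (e1 * e2 + e1 * e3 + e2 * e3) (e4 * e5 + e4 * e6 + e5 * e6) (e7 * e8 + e7 * e9 + e8 * e9)
        (e1 * e2 * e3) (e4 * e5 * e6) (e7 * e8 * e9) =
      4 * (e1 - 1) * e8 * e9
      + (e7 + 1) * ((e9 - e8)^2 - (e5 - e6)^2 + (e2 - e3)^2
          + 2 * (e2 + e3 - 5) * (e8 + e9 + 1) - 1)"
  shows "E6 e1 e2 e3 e4 e5 e6 e7 e8 e9 =
    ST4 (e2 - 1) (e3 - 1) (e5 - 1) (e6 - 1) e8 e9 * E2 s e7 (1 - e1)"
proof -
  have e9: "e9 = 2 * (e1 + e4 + e7) + 3 - e2 - e3 - e5 - e6 - e8"
    using local_exponents unfolding s_def by (simp add: field_simps)
  have s: "s = 1 - e1 - e4 - e7"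
    using local_exponents by (simp add: algebra_simps)
  \<comment> \<open>Hence the factors \<theta> + \<sigma> + 1 and \<theta> + \<sigma> of ST4,
    together with \<theta> + s of E2, give the three factors of E6 that involve s.\<close>
  have \<sigma>: "(3 - (e2 - 1 + (e3 - 1) + (e5 - 1) + (e6 - 1) + e8 + e9)) / 2 = s + 1"
    unfolding s e9 by (simp add: field_simps)
  define T10 where "T10 = E6_T10 (e1 + e2 + e3) (e4 + e5 + e6) (e7 + e8 + e9)
        (e1 * e2 + e1 * e3 + e2 * e3) (e4 * e5 + e4 * e6 + e5 * e6) (e7 * e8 + e7 * e9 + e8 * e9)
        (e1 * e2 * e3) (e4 * e5 * e6) (e7 * e8 * e9)"
  \<comment> \<open>The quadratic factor of the coefficient of \<partial> in ST4, at the shifted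
    parameters.\<close>
  define v where "v = [:1 / 4 * ((e9 - e8)^2 - (e5 - 1 - (e6 - 1))^2 + (e2 - 1 - (e3 - 1))^2
              + 2 * (e2 - 1 + (e3 - 1) - 3) * (e8 + e9 + 1) - 1),
          e2 - 1 + (e3 - 1) - e8 - e9 - 4, - 2:]"
  have T10: "T10 = (e1 - 1) * e8 * e9
      + (e7 + 1) * (1 / 4 * ((e9 - e8)^2 - (e5 - 1 - (e6 - 1))^2 + (e2 - 1 - (e3 - 1))^2
          + 2 * (e2 - 1 + (e3 - 1) - 3) * (e8 + e9 + 1) - 1))"
    using accessory unfolding T10_def[symmetric] by (simp add: field_simps)
  \<comment> \<open>The coefficients of \<partial> on both sides, after cancelling (\<theta> + s +
    2)(\<theta> + s + 1).\<close>
  have B1: "E6_B1 (e1 + e2 + e3) (e4 + e5 + e6) (e7 + e8 + e9)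
        (e1 * e2 + e1 * e3 + e2 * e3) (e4 * e5 + e4 * e6 + e5 * e6) (e7 * e8 + e7 * e9 + e8 * e9)
        (e1 * e2 * e3) (e4 * e5 * e6) (e7 * e8 * e9) =
      v * [:e7 + 1, 1:] - [:e8, 1:] * [:e9, 1:] * [:1 - e1, 1:]"
    unfolding E6_B1_def T10_def[symmetric] T10 v_def unfolding e9
    by (simp add: field_simps power2_eq_square)
  \<comment> \<open>The coefficients of \<partial>^2 on both sides, after cancelling \<theta> + s +
    2. The accessory equation is used again, so no further condition arises.\<close>
  have B2: "E6_B2 (e1 + e2 + e3) (e4 + e5 + e6) (e7 + e8 + e9)
        (e1 * e2 + e1 * e3 + e2 * e3) (e4 * e5 + e4 * e6 + e5 * e6) (e7 * e8 + e7 * e9 + e8 * e9)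
        (e1 * e2 * e3) (e4 * e5 * e6) (e7 * e8 * e9) =
      [:3 - e2, 1:] * [:3 - e3, 1:] * [:e7 + 2, 1:] - v * [:2 - e1, 1:]"
    unfolding E6_B2_def T10_def[symmetric] T10 v_def unfolding e9
    by (simp add: field_simps power2_eq_square power3_eq_cube)
  have \<sigma>': "s + 1 + 1 = s + 2" and e7': "e7 + 1 + 1 = e7 + 2" and e1': "1 - e1 + 1 = 2 - e1"
      "2 - e1 + 1 = 3 - e1" and e2': "2 - (e2 - 1) = 3 - e2" and e3': "2 - (e3 - 1) = 3 - e3"
    by simp_all
  have shift: "[:k, 1:] \<circ>\<^sub>p [:1, 1:] = [:k + 1, 1:]" for k :: complex
    by (simp add: pcompose_pCons)
  show ?thesis
    unfolding E6_at_theta ST4_at_theta E2_at_theta mult_second_order_at_theta \<sigma> B1 B2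
      s_def[symmetric] v_def[symmetric]
    unfolding pcompose_mult pcompose_uminus shift \<sigma>' e7' e1' e2' e3'
    by (simp only: ring_distribs ac_simps mult_minus_left mult_minus_right diff_conv_add_uminus)
qed

text \<open>For use with \<open>algebra\<close>, s is eliminated and denominators are cleared: the
  two equations are 3 times \<open>local_exponents\<close> and 27 times
  \<open>accessory\<close>.\<close>

lemma E6_right_factor:
  assumes "L = E6 e1 e2 e3 e4 e5 e6 e7 e8 e9"
    and "2 * (e1 + e4 + e7) + 3 = e2 + e3 + e5 + e6 + e8 + e9"
    and "2 * (54 * E6_T10 (e1 + e2 + e3) (e4 + e5 + e6) (e7 + e8 + e9)
        (e1 * e2 + e1 * e3 + e2 * e3) (e4 * e5 + e4 * e6 + e5 * e6) (e7 * e8 + e7 * e9 + e8 * e9)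
        (e1 * e2 * e3) (e4 * e5 * e6) (e7 * e8 * e9)) =
      27 * (4 * (e1 - 1) * e8 * e9
      + (e7 + 1) * ((e9 - e8)^2 - (e5 - e6)^2 + (e2 - e3)^2
          + 2 * (e2 + e3 - 5) * (e8 + e9 + 1) - 1))"
  shows "\<exists>A B C Q. L = Q * E2 A B C \<and> (\<exists>\<epsilon>1 \<epsilon>2 \<epsilon>3 \<epsilon>4 \<epsilon>5 \<epsilon>6. Q = ST4 \<epsilon>1 \<epsilon>2 \<epsilon>3 \<epsilon>4 \<epsilon>5 \<epsilon>6)"
proof -
  have "e1 + e4 + e7 = 1 - (6 - (e1 + e2 + e3 + e4 + e5 + e6 + e7 + e8 + e9)) / 3"
    using assms(2) by (simp add: field_simps)
  note factorization = E6_eq_ST4_times_E2[OF this]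
  have "2 * (54 * x) = 27 * y \<Longrightarrow> 4 * x = y" for x y :: complex
    by simp
  from factorization[OF this[OF assms(3)]] show ?thesis
    unfolding assms(1) by blast
qed

theorem theorem6p1:
  fixes a b c g p q r \<delta> \<Delta> :: complex
  assumes "\<delta> = a + b + c"
    and "\<Delta> \<in> {- a, - b, - c, a + g / 2 + 1, b + g / 2 + 1, c + g / 2 + 1,
               - (\<delta> + g / 2 + 1), \<delta> + g + 2, 1 / 2 - g / 2}"
    and "\<Delta> = 0"
  shows "\<exists>A B C Q. SE6 a b c g p q r = Q * E2 A B C \<and>
           (\<exists>\<epsilon>1 \<epsilon>2 \<epsilon>3 \<epsilon>4 \<epsilon>5 \<epsilon>6. Q = ST4 \<epsilon>1 \<epsilon>2 \<epsilon>3 \<epsilon>4 \<epsilon>5 \<epsilon>6)"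
proof -
  define e1 e2 e3 where e123: "e1 = p + r + 1" "e2 = a + c + p + r + 2"
    "e3 = 2 * a + 2 * c + g + p + r + 3"
  define e4 e5 e6 where e456: "e4 = q + r + 1" "e5 = b + c + q + r + 2"
    "e6 = 2 * b + 2 * c + g + q + r + 3"
  define e7 e8 e9 where e789: "e7 = - 2 * c - (p + q + r) - 1"
    "e8 = - (a + b + c) - c - (p + q + r + g) - 2"
    "e9 = - 2 * (a + b + c) - (p + q + r + g) - 3"
  note e = e123 e456 e789
  have SE6: "SE6 a b c g p q r = E6 e1 e2 e3 e4 e5 e6 e7 e8 e9"
    unfolding SE6_def Let_def e ..
  \<comment> \<open>Each condition \<Delta> = 0 is solved for one parameter. Since s = -r here, the
    triple (i, k, j) belonging to \<Delta> satisfies e_i + e_k + e_j = 1 - s + 2\<Delta>, which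
    explains the pairing.\<close>
  consider "a = 0" | "b = 0" | "c = 0" | "g = - 2 * a - 2" | "g = - 2 * b - 2" | "g = - 2 * c - 2"
    | "g = - 2 * (a + b + c) - 2" | "g = - (a + b + c) - 2" | "g = 1"
    using assms by (auto simp: field_simps eq_neg_iff_add_eq_0)
  then show ?thesis
  proof cases
    case 1
    \<comment> \<open>In each case the rotations put e_i, e_k, e_j at positions 1, 4, 7. After
      substitution, both equations are polynomial identities in the remaining parameters.\<close>
    have L: "SE6 a b c g p q r = E6 e1 e2 e3 e6 e4 e5 e9 e7 e8"
      unfolding SE6 by (metis E6_rotate)
    show ?thesis
      by (rule E6_right_factor[OF L]; unfold E6_T10_times_54 e 1) algebra+
  next
    case 2
    have L: "SE6 a b c g p q r = E6 e3 e1 e2 e4 e5 e6 e9 e7 e8"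
      unfolding SE6 by (metis E6_rotate)
    show ?thesis
      by (rule E6_right_factor[OF L]; unfold E6_T10_times_54 e 2) algebra+
  next
    case 3
    have L: "SE6 a b c g p q r = E6 e1 e2 e3 e4 e5 e6 e7 e8 e9"
      unfolding SE6 by (metis E6_rotate)
    show ?thesis
      by (rule E6_right_factor[OF L]; unfold E6_T10_times_54 e 3) algebra+
  next
    case 4
    have L: "SE6 a b c g p q r = E6 e3 e1 e2 e4 e5 e6 e7 e8 e9"
      unfolding SE6 by (metis E6_rotate)
    show ?thesis
      by (rule E6_right_factor[OF L]; unfold E6_T10_times_54 e 4) algebra+
  next
    case 5
    have L: "SE6 a b c g p q r = E6 e1 e2 e3 e6 e4 e5 e7 e8 e9"
      unfolding SE6 by (metis E6_rotate)
    show ?thesis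
      by (rule E6_right_factor[OF L]; unfold E6_T10_times_54 e 5) algebra+
  next
    case 6
    have L: "SE6 a b c g p q r = E6 e3 e1 e2 e6 e4 e5 e9 e7 e8"
      unfolding SE6 by (metis E6_rotate)
    show ?thesis
      by (rule E6_right_factor[OF L]; unfold E6_T10_times_54 e 6) algebra+
  next
    case 7
    have L: "SE6 a b c g p q r = E6 e1 e2 e3 e4 e5 e6 e9 e7 e8"
      unfolding SE6 by (metis E6_rotate)
    show ?thesis
      by (rule E6_right_factor[OF L]; unfold E6_T10_times_54 e 7) algebra+
  next
    case 8
    have L: "SE6 a b c g p q r = E6 e3 e1 e2 e6 e4 e5 e7 e8 e9"
      unfolding SE6 by (metis E6_rotate)
    show ?thesis
      by (rule E6_right_factor[OF L]; unfold E6_T10_times_54 e 8) algebra+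
  next
    case 9
    have L: "SE6 a b c g p q r = E6 e2 e3 e1 e5 e6 e4 e8 e9 e7"
      unfolding SE6 by (metis E6_rotate)
    show ?thesis
      by (rule E6_right_factor[OF L]; unfold E6_T10_times_54 e 9) algebra+
  qed
qed

end
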